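(* Let $n>1$ be an odd number and let $m_1,\dots,m_n>0$. For the curved $n$-body problem in $\mathbb{S}^3$ with masses $m_1,\dots,m_n$, the regular $n$-gon configuration on $\mathbb{S}^1$, that is $\bar{\mathbf q}=(\mathbf q_1,\dots,\mathbf q_n)$ with $\mathbf q_j=(\cos\frac{2\pi j}{n},\sin\frac{2\pi j}{n},0,0)$ for $j=1,\dots,n$, is an equilibrium configuration if and only if $m_1=m_2=\dots=m_n$.
   Context: $\mathbb{S}^3=\{(x,y,z,w)\in\mathbb{R}^4: x^2+y^2+z^2+w^2=1\}$ and $\mathbb{S}^1=\{(x,y,z,w)\in\mathbb{R}^4: x^2+y^2=1,\ z=w=0\}$. The distance $d_{ij}\in[0,\pi]$ between $\mathbf q_i,\mathbf q_j\in\mathbb{S}^3$ is given by $\cos d_{ij}=\mathbf q_i\cdot\mathbf q_j$, where $\cdot$ is the standard scalar product of $\mathbb{R}^4$. The singular set is $\Delta=\bigcup_{1\le i<j\le n}\{\mathbf q\in(\mathbb{S}^3)^n:\mathbf q_i=\pm\mathbf q_j\}$. The potential is $U(\mathbf q)=\sum_{1\le i<j\le n}m_im_j\cot d_{ij}$ on $(\mathbb{S}^3)^n\setminus\Delta$. A configuration $\mathbf q=(\mathbf q_1,\dots,\mathbf q_n)\in(\mathbb{S}^3)^n\setminus\Delta$ is an equilibrium configuration (for the masses $m_1,\dots,m_n$) if it is a critical point of $U$, i.e. if $$\nabla_{\mathbf q_i}U(\mathbf q)=\sum_{j=1,\,j\ne i}^n\frac{m_im_j[\mathbf q_j-\cos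 d_{ij}\,\mathbf q_i]}{\sin^3 d_{ij}}=\mathbf 0,\qquad i=1,\dots,n.$$ *)

theory Defs
  imports "HOL-Analysis.Analysis"
begin

text \<open>
  Configurations of n points are functions on the indices {1..n}; values outside this range are
  irrelevant. The unit 3-sphere is the library set \<^term>\<open>sphere (0 :: real^4) 1\<close>.
\<close>

definition sdist :: "real^4 \<Rightarrow> real^4 \<Rightarrow> real" where
  "sdist x y = arccos (x \<bullet> y)"

definition sphere_configs :: "nat \<Rightarrow> (nat \<Rightarrow> real^4) set" where
  "sphere_configs n = {q. \<forall>i\<in>{1..n}. q i \<in> sphere 0 1}"

definition singular_set :: "nat \<Rightarrow> (nat \<Rightarrow> real^4) set" where
  "singular_set n =
     {q \<in> sphere_configs n. \<exists>i j. 1 \<le> i \<and> i < j \<and> j \<le> n \<and> (q i = q j \<or> q i = - q j)}"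

definition potential :: "nat \<Rightarrow> (nat \<Rightarrow> real) \<Rightarrow> (nat \<Rightarrow> real^4) \<Rightarrow> real" where
  "potential n m q = (\<Sum>i\<in>{1..n}. \<Sum>j\<in>{i<..n}. m i * m j * cot (sdist (q i) (q j)))"

text \<open>
  Critical points of a function on the manifold of n-tuples of points of the 3-sphere: the
  derivative vanishes along every curve in the manifold through the point. The curves are only
  required to be differentiable at time 0.
\<close>

definition critical_point :: "nat \<Rightarrow> ((nat \<Rightarrow> real^4) \<Rightarrow> real) \<Rightarrow> (nat \<Rightarrow> real^4) \<Rightarrow> bool" where
  "critical_point n U q \<longleftrightarrow>
     (\<forall>c :: real \<Rightarrow> nat \<Rightarrow> real^4.
        c 0 = q \<and> (\<forall>t. c t \<in> sphere_configs n) \<and>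
        (\<forall>i\<in>{1..n}. (\<lambda>t. c t i) differentiable (at 0))
        \<longrightarrow> ((\<lambda>t. U (c t)) has_real_derivative 0) (at 0))"

definition equilibrium :: "nat \<Rightarrow> (nat \<Rightarrow> real) \<Rightarrow> (nat \<Rightarrow> real^4) \<Rightarrow> bool" where
  "equilibrium n m q \<longleftrightarrow>
     q \<in> sphere_configs n - singular_set n \<and> critical_point n (potential n m) q"

definition regular_polygon :: "nat \<Rightarrow> nat \<Rightarrow> real^4" where
  "regular_polygon n j =
     vector [cos (2 * pi * real j / real n), sin (2 * pi * real j / real n), 0, 0]"

lemma regular_polygon_components:
  "regular_polygon n j $ 1 = cos (2 * pi * real j / real n)"
  "regular_polygon n j $ 2 = sin (2 * pi * real j / real n)"
  "regular_polygon n j $ 3 = 0"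
  "regular_polygon n j $ 4 = 0"
  by (simp_all add: regular_polygon_def vector_def)

text \<open>The gradient of the potential, and its vanishing as a characterization of equilibria.\<close>

definition grad_potential :: "nat \<Rightarrow> (nat \<Rightarrow> real) \<Rightarrow> (nat \<Rightarrow> real^4) \<Rightarrow> nat \<Rightarrow> real^4" where
  "grad_potential n m q i =
     (\<Sum>j\<in>{1..n} - {i}. (m i * m j / sin (sdist (q i) (q j)) ^ 3) *\<^sub>R
        (q j - cos (sdist (q i) (q j)) *\<^sub>R q i))"

lemma inner_sphere_bounds:
  fixes x y :: "real^4"
  assumes "x \<in> sphere 0 1" "y \<in> sphere 0 1" "x \<noteq> y" "x \<noteq> - y"
  shows "- 1 < x \<bullet> y" "x \<bullet> y < 1"
proof -
  have nx: "x \<bullet> x = 1" and ny: "y \<bullet> y = 1"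
    using assms by (auto simp: dot_square_norm)
  have "0 < (x - y) \<bullet> (x - y)" "0 < (x + y) \<bullet> (x + y)"
    using assms by (auto simp: add_eq_0_iff2)
  then show "- 1 < x \<bullet> y" "x \<bullet> y < 1"
    using nx ny by (auto simp: inner_simps inner_commute)
qed

lemma sum_pairs_symmetrize:
  fixes F :: "nat \<Rightarrow> nat \<Rightarrow> real"
  shows "(\<Sum>i\<in>{1..n}. \<Sum>j\<in>{i<..n}. F i j + F j i) = (\<Sum>i\<in>{1..n}. \<Sum>j\<in>{1..n} - {i}. F i j)"
proof -
  have "(\<Sum>i\<in>{1..n}. \<Sum>j\<in>{i<..n}. F j i) = (\<Sum>j\<in>{1..n}. \<Sum>i\<in>{1..<j}. F j i)"
    unfolding sum.Sigma[OF finite_atLeastAtMost ballI[OF finite_greaterThanAtMost]]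
      sum.Sigma[OF finite_atLeastAtMost ballI[OF finite_atLeastLessThan]]
    by (rule sum.reindex_bij_witness[of _ "\<lambda>(a,b). (b,a)" "\<lambda>(a,b). (b,a)"]) auto
  moreover have "(\<Sum>j\<in>{1..n} - {i}. F i j) = (\<Sum>j\<in>{i<..n}. F i j) + (\<Sum>j\<in>{1..<i}. F i j)"
    if "i \<in> {1..n}" for i
  proof -
    have "{1..n} - {i} = {i<..n} \<union> {1..<i}"
      using that by auto
    then show ?thesis
      by (simp add: sum.union_disjoint Int_def)
  qed
  ultimately show ?thesis
    by (simp add: sum.distrib)
qed

lemma potential_has_derivative_along_curve:
  fixes c :: "real \<Rightarrow> nat \<Rightarrow> real^4"
  assumes nonsing: "q \<in> sphere_configs n - singular_set n"
    and c0: "c 0 = q" and c_sphere: "\<And>t. c t \<in> sphere_configs n"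
    and deriv: "\<And>i. i \<in> {1..n} \<Longrightarrow> ((\<lambda>t. c t i) has_vector_derivative v i) (at 0)"
  shows "((\<lambda>t. potential n m (c t)) has_real_derivative
            (\<Sum>i\<in>{1..n}. grad_potential n m q i \<bullet> v i)) (at 0)"
proof -
  have tangent: "q i \<bullet> v i = 0" if i: "i \<in> {1..n}" for i
  proof -
    have "((\<lambda>t. c t i \<bullet> c t i) has_vector_derivative (c 0 i \<bullet> v i + v i \<bullet> c 0 i)) (at 0)"
      by (rule bounded_bilinear.has_vector_derivative[OF bounded_bilinear_inner deriv[OF i] deriv[OF i]])
    moreover have "(\<lambda>t. c t i \<bullet> c t i) = (\<lambda>t. 1)"
      using c_sphere i by (auto simp: sphere_configs_def dot_square_norm)
    ultimately have "c 0 i \<bullet> v i + v i \<bullet> c 0 i = 0"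
      using vector_derivative_unique_at[OF _ has_vector_derivative_const] by metis
    then show ?thesis
      by (simp add: c0 inner_commute)
  qed
  define F where "F i j = m i * m j / sin (sdist (q i) (q j)) ^ 3 * (q j \<bullet> v i)" for i j
  have pair_deriv: "((\<lambda>t. m i * m j * cot (sdist (c t i) (c t j))) has_real_derivative F i j + F j i) (at 0)"
    if "i \<in> {1..n}" "j \<in> {i<..n}" for i j
  proof -
    have "q i \<in> sphere 0 1" "q j \<in> sphere 0 1" "q i \<noteq> q j" "q i \<noteq> - q j"
      using nonsing that by (auto simp: sphere_configs_def singular_set_def)
    note b = inner_sphere_bounds[OF this]
    define p where "p = q i \<bullet> q j"
    have p: "- 1 < p" "p < 1" using b by (auto simp: p_def)
    have s: "sin (arccos p) > 0"
      using p by (intro sin_gt_zero arccos_lt_bounded[THEN conjunct1] arccos_lt_bounded[THEN conjunct2]) auto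
    have root: "sqrt (1 - p\<^sup>2) = sin (arccos p)"
      using p by (simp add: sin_arccos)
    have "((\<lambda>t. c t i \<bullet> c t j) has_vector_derivative (c 0 i \<bullet> v j + v i \<bullet> c 0 j)) (at 0)"
      using that by (intro bounded_bilinear.has_vector_derivative[OF bounded_bilinear_inner] deriv) auto
    then have di: "((\<lambda>t. c t i \<bullet> c t j) has_real_derivative (q i \<bullet> v j + q j \<bullet> v i)) (at 0)"
      by (simp add: has_real_derivative_iff_has_vector_derivative c0 inner_commute)
    have "(arccos has_real_derivative inverse (- sqrt (1 - p\<^sup>2))) (at p)"
      by (rule DERIV_arccos) (use p in auto)
    then have da: "((\<lambda>t. sdist (c t i) (c t j)) has_real_derivative
        inverse (- sin (arccos p)) * (q i \<bullet> v j + q j \<bullet> v i)) (at 0)"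
      unfolding sdist_def root
      by (intro DERIV_chain2[where f = arccos, OF _ di]) (simp add: c0 p_def)
    have "(cot has_real_derivative - inverse ((sin (arccos p))\<^sup>2)) (at (arccos p))"
      by (rule DERIV_cot) (use s in simp)
    then have "((\<lambda>t. cot (sdist (c t i) (c t j))) has_real_derivative
        - inverse ((sin (arccos p))\<^sup>2) * (inverse (- sin (arccos p)) * (q i \<bullet> v j + q j \<bullet> v i))) (at 0)"
      by (intro DERIV_chain2[where f = cot, OF _ da]) (simp add: c0 p_def sdist_def)
    then have "((\<lambda>t. m i * m j * cot (sdist (c t i) (c t j))) has_real_derivative m i * m j *
        (- inverse ((sin (arccos p))\<^sup>2) * (inverse (- sin (arccos p)) * (q i \<bullet> v j + q j \<bullet> v i)))) (at 0)"
      by (rule DERIV_cmult)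
    moreover have "m i * m j *
        (- inverse ((sin (arccos p))\<^sup>2) * (inverse (- sin (arccos p)) * (q i \<bullet> v j + q j \<bullet> v i)))
        = F i j + F j i"
      using s by (simp add: F_def sdist_def p_def inner_commute[of "q j" "q i"] field_simps
          power2_eq_square power3_eq_cube)
    ultimately show ?thesis by simp
  qed
  have "((\<lambda>t. potential n m (c t)) has_real_derivative
      (\<Sum>i\<in>{1..n}. \<Sum>j\<in>{i<..n}. F i j + F j i)) (at 0)"
    unfolding potential_def by (intro DERIV_sum pair_deriv)
  moreover have "(\<Sum>j\<in>{1..n} - {i}. F i j) = grad_potential n m q i \<bullet> v i" if "i \<in> {1..n}" for i
    using tangent[OF that]
    by (simp add: F_def grad_potential_def inner_sum_left inner_diff_left)
  then have "(\<Sum>i\<in>{1..n}. \<Sum>j\<in>{1..n} - {i}. F i j) = (\<Sum>i\<in>{1..n}. grad_potential n m q i \<bullet> v i)"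
    by (rule sum.cong[OF refl])
  ultimately show ?thesis
    unfolding sum_pairs_symmetrize by simp
qed

theorem equilibrium_iff_grad_potential:
  "equilibrium n m q \<longleftrightarrow>
     q \<in> sphere_configs n - singular_set n \<and> (\<forall>i\<in>{1..n}. grad_potential n m q i = 0)"
proof (intro iffI conjI)
  assume eq: "equilibrium n m q"
  then show q: "q \<in> sphere_configs n - singular_set n"
    by (simp add: equilibrium_def)
  define g where "g = grad_potential n m q"
  have qg: "q i \<bullet> g i = 0" if i: "i \<in> {1..n}" for i
  proof -
    have "q i \<bullet> (q j - cos (sdist (q i) (q j)) *\<^sub>R q i) = 0" if "j \<in> {1..n} - {i}" for j
    proof -
      have n1: "norm (q i) = 1" "norm (q j) = 1"
        using q i that by (auto simp: sphere_configs_def)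
      have "\<bar>q i \<bullet> q j\<bar> \<le> 1"
        using Cauchy_Schwarz_ineq2[of "q i" "q j"] n1 by simp
      then show ?thesis
        using n1 by (simp add: sdist_def inner_diff_right dot_square_norm cos_arccos_abs)
    qed
    then show ?thesis
      by (simp add: g_def grad_potential_def inner_sum_right)
  qed
  define c where "c t i = (q i + t *\<^sub>R g i) /\<^sub>R sqrt (1 + t\<^sup>2 * (g i \<bullet> g i))" for t i
  have c0: "c 0 = q"
    by (auto simp: c_def)
  have cs: "c t \<in> sphere_configs n" for t
  proof -
    have "norm (c t i) = 1" if i: "i \<in> {1..n}" for i
    proof -
      have "norm (q i) = 1" using q i by (auto simp: sphere_configs_def)
      then have "q i \<bullet> q i = 1" by (simp add: dot_square_norm)
      then have "(q i + t *\<^sub>R g i) \<bullet> (q i + t *\<^sub>R g i) = 1 + t\<^sup>2 * (g i \<bullet> g i)"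
        using qg[OF i] by (simp add: inner_simps inner_commute[of "g i" "q i"] power2_eq_square)
      then have "norm (q i + t *\<^sub>R g i) = sqrt (1 + t\<^sup>2 * (g i \<bullet> g i))"
        by (simp add: norm_eq_sqrt_inner)
      moreover have "1 + t\<^sup>2 * (g i \<bullet> g i) > 0"
        by (intro add_pos_nonneg) auto
      ultimately show ?thesis
        by (simp add: c_def)
    qed
    then show ?thesis by (auto simp: sphere_configs_def)
  qed
  have cd: "((\<lambda>t. c t i) has_vector_derivative g i) (at 0)" for i
  proof -
    have "((\<lambda>t. inverse (sqrt (1 + t\<^sup>2 * (g i \<bullet> g i)))) has_real_derivative 0) (at 0)"
      by (auto intro!: derivative_eq_intros)
    moreover have "((\<lambda>t. q i + t *\<^sub>R g i) has_vector_derivative g i) (at 0)"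
      by (auto intro!: derivative_eq_intros)
    ultimately have "((\<lambda>t. inverse (sqrt (1 + t\<^sup>2 * (g i \<bullet> g i))) *\<^sub>R (q i + t *\<^sub>R g i))
        has_vector_derivative inverse (sqrt (1 + 0\<^sup>2 * (g i \<bullet> g i))) *\<^sub>R g i + 0 *\<^sub>R (q i + 0 *\<^sub>R g i)) (at 0)"
      by (rule has_vector_derivative_scaleR)
    then show ?thesis by (simp add: c_def)
  qed
  have "((\<lambda>t. potential n m (c t)) has_real_derivative (\<Sum>i\<in>{1..n}. g i \<bullet> g i)) (at 0)"
    using potential_has_derivative_along_curve[where v = g, OF q c0 cs cd] by (simp add: g_def)
  moreover have "((\<lambda>t. potential n m (c t)) has_real_derivative 0) (at 0)"
    using eq c0 cs cd unfolding equilibrium_def critical_point_def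
    by (metis differentiableI_vector)
  ultimately have "(\<Sum>i\<in>{1..n}. g i \<bullet> g i) = 0"
    by (rule DERIV_unique)
  then show "\<forall>i\<in>{1..n}. grad_potential n m q i = 0"
    by (subst (asm) sum_nonneg_eq_0_iff) (auto simp: g_def)
next
  assume *: "q \<in> sphere_configs n - singular_set n \<and> (\<forall>i\<in>{1..n}. grad_potential n m q i = 0)"
  have "((\<lambda>t. potential n m (c t)) has_real_derivative 0) (at 0)"
    if "c 0 = q" "\<And>t. c t \<in> sphere_configs n"
      "\<And>i. i \<in> {1..n} \<Longrightarrow> (\<lambda>t. c t i) differentiable (at 0)" for c :: "real \<Rightarrow> nat \<Rightarrow> real^4"
    using potential_has_derivative_along_curve[where v = "\<lambda>i. vector_derivative (\<lambda>t. c t i) (at 0)"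
        and c = c and q = q and n = n and m = m] that * by (simp add: vector_derivative_works)
  then show "equilibrium n m q"
    using * unfolding equilibrium_def critical_point_def by blast
qed

end

theory Submission
  imports Defs
begin

text \<open>
  At the regular polygon the force on the i-th point is tangent to the circle, and its signed size
  is \<open>m\<^sub>i\<close> times \<open>\<Sum>\<^sub>j m\<^sub>j s(j - i)\<close>, where \<open>s(t) = sin x / \<bar>sin x\<bar>\<^sup>3\<close> with
  \<open>x = 2 \<pi> t / n\<close>. Equilibria are therefore the mass vectors in the kernel of the circulant matrix
  of \<open>s\<close>. Constant vectors lie in it because \<open>s\<close> is odd. For the converse one has to
  see that the kernel is one-dimensional, that is, that the Fourier coefficient
  \<open>A(l) = \<Sum>\<^sub>u s(u) sin (2 \<pi> l u / n)\<close> is nonzero for \<open>0 < l < n\<close>.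

  The factor \<open>sin\<^sup>2 x\<close> in the identity
  \<open>sin ((l + 2) x) - 2 sin (l x) + sin ((l - 2) x) = - 4 sin\<^sup>2 x sin (l x)\<close> cancels the singularity
  of \<open>s\<close>: the second difference of \<open>A\<close> with step 2 is \<open>- 4 \<Sum>\<^sub>u sgn (sin x\<^sub>u) sin (l x\<^sub>u)\<close>, a sum
  that telescopes and is negative for odd \<open>l < n\<close>
  (\<open>fourier_kernel_second_difference\<close>, \<open>sum_sgn_sin_pos\<close>). So \<open>A\<close> is strictly concave along the odd
  numbers from \<open>1\<close> to \<open>n\<close>; as \<open>A(1) > 0\<close> and \<open>A(n) = 0\<close>, it is positive at odd \<open>l < n\<close>.
  The reflection \<open>A(n - l) = - A(l)\<close> turns this into negativity at even \<open>l\<close>, again because \<open>n\<close> is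
  odd. Fourier inversion then shows that every mass equals the mean mass
  (\<open>kernel_balanced_imp_mean\<close>).
\<close>

section \<open>Sums of periodic functions\<close>

definition angle :: "nat \<Rightarrow> int \<Rightarrow> real" where
  "angle n t = 2 * pi * of_int t / real n"

lemma sum_periodic_shift:
  fixes f :: "int \<Rightarrow> real"
  assumes "\<And>t. f (t + int n) = f t"
  shows "(\<Sum>i\<in>{1..n}. f (int i + c)) = (\<Sum>i\<in>{1..n}. f (int i))"
proof -
  have step: "(\<Sum>i\<in>{1..n}. f (int i + (c + 1))) = (\<Sum>i\<in>{1..n}. f (int i + c))" for c
  proof -
    have "(\<Sum>i\<in>{1..n}. f (int (Suc i) + c) - f (int i + c)) = f (int (Suc n) + c) - f (int 1 + c)"
      using sum_Suc_diff[of 1 n "\<lambda>i. f (int i + c)"] by simp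
    also have "\<dots> = 0"
      using assms[of "1 + c"] by (simp add: algebra_simps)
    finally show ?thesis
      by (simp add: sum_subtractf algebra_simps)
  qed
  show ?thesis
  proof (induction c rule: int_induct[where k = 0])
    case (step2 i)
    then show ?case using step[of "i - 1"] by simp
  qed (use step in simp_all)
qed

lemma sum_odd_periodic_eq_0:
  fixes f :: "int \<Rightarrow> real"
  assumes per: "\<And>t. f (t + int n) = f t" and odd: "\<And>t. f (- t) = - f t"
  shows "(\<Sum>i\<in>{1..n}. f (int i)) = 0"
proof -
  have "(\<Sum>i\<in>{1..n}. f (int i)) = (\<Sum>i\<in>{1..n}. f (int (n + 1 - i)))"
    by (subst sum.atLeastAtMost_rev) simp
  also have "\<dots> = (\<Sum>i\<in>{1..n}. - f (int i + (- 1)))"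
  proof (rule sum.cong)
    fix i assume "i \<in> {1..n}"
    then have "int (n + 1 - i) = - (int i + (- 1)) + int n" by auto
    then show "f (int (n + 1 - i)) = - f (int i + (- 1))" using per odd by metis
  qed simp
  also have "\<dots> = - (\<Sum>i\<in>{1..n}. f (int i))"
    using sum_periodic_shift[of f n, OF per, of "- 1"] by (simp add: sum_negf)
  finally show ?thesis by simp
qed

lemma angle_periodic:
  assumes "n > 0"
  shows "angle n (t + int n) = angle n t + 2 * pi"
  using assms by (simp add: angle_def field_simps)

lemma sin_angle_eq_0_iff:
  assumes "odd n"
  shows "sin (angle n t) = 0 \<longleftrightarrow> int n dvd t"
proof
  have n: "real n > 0" using assms by (auto intro: odd_pos)
  assume "sin (angle n t) = 0"
  then obtain k :: int where "2 * pi * of_int t / real n = of_int k * pi"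
    unfolding sin_zero_iff_int2 angle_def by auto
  then have "2 * real_of_int t = of_int k * real n"
    using n by (simp add: field_simps)
  then have "real_of_int (2 * t) = of_int (k * int n)" by simp
  then have "2 * t = k * int n" by linarith
  then have "int n dvd 2 * t" by simp
  moreover have "coprime (int n) 2" using assms by simp
  ultimately show "int n dvd t" by (simp add: coprime_dvd_mult_right_iff)
next
  assume "int n dvd t"
  then obtain k where "t = int n * k" ..
  then show "sin (angle n t) = 0"
    using assms by (auto simp: angle_def sin_zero_iff_int2 intro!: exI[of _ "2 * k"])
qed

lemma sum_cos_multiples_eq_0:
  assumes "odd n" and "\<not> int n dvd t"
  shows "(\<Sum>l<n. cos (real l * angle n t)) = 0"
proof -
  define x where "x = angle n t"
  have n: "real n * x = 2 * pi * of_int t"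
    using assms by (auto simp: x_def angle_def)
  have "2 * sin x * (\<Sum>l<n. cos (real l * x))
      = (\<Sum>l<n. (sin (real (Suc l) * x) + sin ((real (Suc l) - 1) * x)) -
               (sin (real l * x) + sin ((real l - 1) * x)))"
    unfolding sum_distrib_left
    by (intro sum.cong refl) (simp add: ring_distribs sin_add sin_diff)
  also have "\<dots> = (sin (real n * x) + sin ((real n - 1) * x)) - (sin 0 + sin (- x))"
    by (subst sum_lessThan_telescope) simp
  also have "\<dots> = 0"
    unfolding left_diff_distrib n by (simp add: sin_diff sin_int_2pin cos_int_2pin)
  finally show ?thesis
    using sin_angle_eq_0_iff[OF assms(1), of t] assms(2) by (simp add: x_def)
qed

section \<open>The Fourier coefficients of the force kernel\<close>

definition force_kernel :: "nat \<Rightarrow> int \<Rightarrow> real" where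
  "force_kernel n t = sin (angle n t) / \<bar>sin (angle n t)\<bar> ^ 3"

definition fourier_kernel :: "nat \<Rightarrow> nat \<Rightarrow> real" where
  "fourier_kernel n l = (\<Sum>u\<in>{1..n}. force_kernel n (int u) * sin (real l * angle n (int u)))"

lemma force_kernel_minus: "force_kernel n (- t) = - force_kernel n t"
  by (simp add: force_kernel_def angle_def)

lemma force_kernel_periodic: "n > 0 \<Longrightarrow> force_kernel n (t + int n) = force_kernel n t"
  by (simp add: force_kernel_def angle_periodic)

lemma sin_cos_add_multiple_2pi:
  "sin (x + real l * (2 * pi)) = sin x" "cos (x + real l * (2 * pi)) = cos x"
  using sin.plus_of_nat[of x l] cos.plus_of_nat[of x l]
  by (simp_all add: mult_ac)

text \<open>
  The two halves of the period contribute equally, and over one half, where the sign is constant,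
  multiplication by \<open>2 sin (\<pi> l / n)\<close> makes the sum telescope to \<open>cos (\<pi> l / n) - cos (\<pi> l)\<close>.
\<close>

lemma sum_sgn_sin_pos:
  assumes "odd n" and "odd l" and "l < n"
  shows "(\<Sum>u\<in>{1..n}. sgn (sin (angle n (int u))) * sin (real l * angle n (int u))) > 0"
proof -
  obtain N where N: "n = 2 * N + 1" using assms(1) by (auto elim: oddE)
  define g where "g u = sgn (sin (angle n (int u))) * sin (real l * angle n (int u))" for u
  define y where "y = pi * real l / real n"
  have n0: "real n > 0" by (simp add: N)
  have y: "0 < y" "y < pi"
    using assms n0 odd_pos[of l] by (simp_all add: y_def field_simps)
  have refl: "g (n - u) = g u" if "u \<le> n" for u
  proof -
    have "angle n (int (n - u)) = 2 * pi - angle n (int u)"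
      using that n0 by (simp add: angle_def of_nat_diff field_simps)
    moreover have "sin (real l * (2 * pi - angle n (int u))) = - sin (real l * angle n (int u))"
      using sin_cos_add_multiple_2pi(1)[of "- (real l * angle n (int u))" l]
      by (simp add: algebra_simps)
    ultimately show ?thesis
      by (simp add: g_def sgn_minus)
  qed
  have gn: "g n = 0"
    using refl[of n] by (simp add: g_def angle_def)
  have "{1..n} = {1..N} \<union> ({N + 1..2 * N} \<union> {n})" by (auto simp: N)
  then have "(\<Sum>u\<in>{1..n}. g u) = (\<Sum>u\<in>{1..N}. g u) + (\<Sum>u\<in>{N + 1..2 * N}. g u)"
    using gn by (simp add: sum.union_disjoint N)
  also have "(\<Sum>u\<in>{N + 1..2 * N}. g u) = (\<Sum>u\<in>{1..N}. g u)"
    by (rule sum.reindex_bij_witness[of _ "\<lambda>u. n - u" "\<lambda>u. n - u"]) (use refl N in auto)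
  also have "(\<Sum>u\<in>{1..N}. g u) = (\<Sum>u\<in>{1..N}. sin (2 * real u * y))"
  proof (rule sum.cong)
    fix u assume u: "u \<in> {1..N}"
    then have "2 * real u < real n" "real u > 0" by (auto simp: N)
    then have "0 < angle n (int u)" "angle n (int u) < pi"
      using n0 by (simp_all add: angle_def field_simps)
    then have "sin (angle n (int u)) > 0" by (rule sin_gt_zero)
    then show "g u = sin (2 * real u * y)"
      by (simp add: g_def angle_def y_def mult_ac)
  qed simp
  finally have halves: "(\<Sum>u\<in>{1..n}. g u) = 2 * (\<Sum>u\<in>{1..N}. sin (2 * real u * y))"
    by simp
  have "2 * sin y * (\<Sum>u\<in>{1..N}. sin (2 * real u * y))
      = (\<Sum>u\<in>{1..N}. - cos ((2 * real (Suc u) - 1) * y) - - cos ((2 * real u - 1) * y))"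
    unfolding sum_distrib_left
  proof (rule sum.cong)
    fix u
    have e: "(2 * real (Suc u) - 1) * y = 2 * real u * y + y" "(2 * real u - 1) * y = 2 * real u * y - y"
      by (simp_all add: algebra_simps)
    show "2 * sin y * sin (2 * real u * y)
        = - cos ((2 * real (Suc u) - 1) * y) - - cos ((2 * real u - 1) * y)"
      unfolding e by (simp add: cos_add cos_diff)
  qed simp
  then have "2 * sin y * (\<Sum>u\<in>{1..N}. sin (2 * real u * y)) = cos y - cos (real n * y)"
    by (subst (asm) sum_Suc_diff) (simp_all add: N algebra_simps)
  moreover have "cos (real n * y) = - 1"
    using n0 assms(2) by (simp add: y_def cos_npi mult.commute)
  moreover have "cos y > - 1"
    using cos_monotone_0_pi[of y pi] y by simp
  ultimately have "2 * sin y * (\<Sum>u\<in>{1..N}. sin (2 * real u * y)) > 0" by linarith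
  then have "(\<Sum>u\<in>{1..N}. sin (2 * real u * y)) > 0"
    using sin_gt_zero[OF y] by (simp add: zero_less_mult_iff)
  then show ?thesis using halves by (simp add: g_def)
qed

lemma fourier_kernel_second_difference:
  "fourier_kernel n (l + 4) - 2 * fourier_kernel n (l + 2) + fourier_kernel n l =
    - 4 * (\<Sum>u\<in>{1..n}. sgn (sin (angle n (int u))) * sin (real (l + 2) * angle n (int u)))"
proof -
  have "force_kernel n u * sin (real (l + 4) * x) - 2 * (force_kernel n u * sin (real (l + 2) * x))
      + force_kernel n u * sin (real l * x) = - 4 * (sgn (sin x) * sin (real (l + 2) * x))"
    if x: "x = angle n u" for u x
  proof -
    define z where "z = real (l + 2) * x"
    have e: "real (l + 4) * x = z + 2 * x" "real l * x = z - 2 * x"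
      by (simp_all add: z_def algebra_simps)
    have "sin (z + 2 * x) - 2 * sin z + sin (z - 2 * x) = 2 * sin z * cos (2 * x) - 2 * sin z"
      by (simp add: sin_add sin_diff)
    also have "\<dots> = - 4 * (sin x)\<^sup>2 * sin z"
      unfolding cos_double_sin by (simp add: algebra_simps)
    finally have "force_kernel n u * (sin (z + 2 * x) - 2 * sin z + sin (z - 2 * x))
        = - 4 * (force_kernel n u * (sin x)\<^sup>2 * sin z)"
      by simp
    also have "force_kernel n u * (sin x)\<^sup>2 = sgn (sin x)"
      by (cases "sin x" "0::real" rule: linorder_cases)
        (auto simp: force_kernel_def x[symmetric] power2_eq_square power3_eq_cube)
    finally show ?thesis
      unfolding e z_def[symmetric] by (simp add: algebra_simps)
  qed
  then show ?thesis
    unfolding fourier_kernel_def sum_distrib_left sum.distrib[symmetric] sum_subtractf[symmetric]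
    by (intro sum.cong refl) auto
qed

lemma fourier_kernel_at_1_pos:
  assumes "odd n" and "n > 1"
  shows "fourier_kernel n 1 > 0"
proof -
  have nonneg: "force_kernel n (int u) * sin (angle n (int u)) \<ge> 0" for u
    by (auto simp: force_kernel_def zero_le_mult_iff zero_le_divide_iff)
  have "\<not> int n dvd 1" using assms by simp
  then have "sin (angle n 1) \<noteq> 0" using sin_angle_eq_0_iff[OF assms(1)] by blast
  then have "force_kernel n (int 1) * sin (angle n (int 1)) > 0"
    by (auto simp: force_kernel_def zero_less_mult_iff zero_less_divide_iff)
  then show ?thesis
    unfolding fourier_kernel_def using assms nonneg
    by (simp, intro sum_pos2[of _ 1]) auto
qed

lemma fourier_kernel_reflect:
  assumes "l \<le> n" and "n > 0"
  shows "fourier_kernel n (n - l) = - fourier_kernel n l"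
proof -
  have "sin (real (n - l) * angle n (int u)) = - sin (real l * angle n (int u))" for u
  proof -
    have "real (n - l) * angle n (int u) = - (real l * angle n (int u)) + real u * (2 * pi)"
      using assms by (simp add: angle_def of_nat_diff field_simps)
    then show ?thesis by (simp only: sin_cos_add_multiple_2pi sin_minus)
  qed
  then show ?thesis by (simp add: fourier_kernel_def sum_negf)
qed

text \<open>A strictly concave sequence attains its minimum only at an end of the interval.\<close>

lemma strictly_concave_sequence_pos:
  fixes B :: "nat \<Rightarrow> real"
  assumes conc: "\<And>r. r + 2 \<le> N \<Longrightarrow> B (r + 2) - 2 * B (r + 1) + B r < 0"
    and "B 0 > 0" "B N = 0" "r < N"
  shows "B r > 0"
proof (rule ccontr)
  assume r: "\<not> B r > 0"
  have interior: "\<not> (\<forall>k\<le>N. B p \<le> B k)" if "0 < p" "p < N" for p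
  proof
    assume "\<forall>k\<le>N. B p \<le> B k"
    then have "B p \<le> B (p - 1)" "B p \<le> B (p + 1)" using that by auto
    then show False using conc[of "p - 1"] that by (simp add: Suc_le_eq eval_nat_numeral)
  qed
  obtain p where p: "p \<le> N" "\<forall>k\<le>N. B p \<le> B k"
    using ex_min_if_finite[of "B ` {..N}"] by (auto simp: not_less)
  have "B p \<le> B r" using p assms by simp
  then have "p \<noteq> 0" using r assms by (metis not_le order.strict_trans1)
  then have "p = N" using p interior[of p] by fastforce
  then have "\<forall>k\<le>N. B r \<le> B k" using p r assms by auto
  moreover have "r \<noteq> 0" using r assms by metis
  ultimately show False using interior[of r] assms by blast
qed

text \<open>
  With step 2 the frequencies \<open>1, 3, \<dots>, n\<close> run through the odd numbers, which is where the
  second difference of the Fourier coefficients is known to be negative.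
\<close>

lemma fourier_kernel_odd_pos:
  assumes "odd n" "odd l" "l < n"
  shows "fourier_kernel n l > 0"
proof -
  obtain N where N: "n = 2 * N + 1" using assms(1) by (auto elim: oddE)
  obtain r where r: "l = 2 * r + 1" using assms(2) by (auto elim: oddE)
  have "fourier_kernel n (2 * r + 1) > 0"
  proof (rule strictly_concave_sequence_pos[where N = N and B = "\<lambda>r. fourier_kernel n (2 * r + 1)"])
    fix k assume k: "k + 2 \<le> N"
    then show "fourier_kernel n (2 * (k + 2) + 1) - 2 * fourier_kernel n (2 * (k + 1) + 1)
        + fourier_kernel n (2 * k + 1) < 0"
    proof -
      have idx: "2 * (k + 2) + 1 = (2 * k + 1) + 4" "2 * (k + 1) + 1 = (2 * k + 1) + 2"
        by simp_all
      have "odd (2 * k + 1 + 2)" "2 * k + 1 + 2 < n" using k by (simp_all add: N)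
      then show ?thesis
        unfolding idx using fourier_kernel_second_difference[of n "2 * k + 1"]
          sum_sgn_sin_pos[OF assms(1), of "2 * k + 1 + 2"] by linarith
    qed
  next
    show "fourier_kernel n (2 * 0 + 1) > 0"
      using fourier_kernel_at_1_pos[of n] assms r by simp
    show "fourier_kernel n (2 * N + 1) = 0"
      using fourier_kernel_reflect[of 0 n] by (simp add: N fourier_kernel_def)
    show "r < N" using assms r N by simp
  qed
  then show ?thesis by (simp add: r)
qed

lemma fourier_kernel_nonzero:
  assumes "odd n" "0 < l" "l < n"
  shows "fourier_kernel n l \<noteq> 0"
proof (cases "odd l")
  case True
  then show ?thesis using fourier_kernel_odd_pos assms by fastforce
next
  case False
  then have "fourier_kernel n (n - l) > 0"
    using assms by (intro fourier_kernel_odd_pos) auto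
  then show ?thesis using fourier_kernel_reflect[of l n] assms by simp
qed

section \<open>The kernel of the circulant matrix\<close>

text \<open>
  Convolving \<open>s\<close> with a sine of frequency l gives a cosine of the same frequency: in the
  addition theorem for \<open>sin (l (\<theta>\<^sub>p - \<theta>\<^sub>j) - l \<theta>\<^sub>u)\<close> the cosine of \<open>l \<theta>\<^sub>u\<close> is annihilated because
  \<open>s\<close> is odd.
\<close>

lemma sum_force_kernel_sin:
  assumes "n > 0"
  shows "(\<Sum>i\<in>{1..n}. sin (real l * angle n (p - int i)) * force_kernel n (j - int i)) =
    fourier_kernel n l * cos (real l * angle n (p - j))"
proof -
  define g where "g u = sin (real l * angle n (p - j - u)) * force_kernel n u" for u
  have g_per: "g (t + int n) = g t" for t
  proof -
    have "angle n (p - j - t) = angle n (p - j - (t + int n)) + 2 * pi"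
      using angle_periodic[OF assms, of "p - j - (t + int n)"] by (simp add: algebra_simps)
    then have "real l * angle n (p - j - t) = real l * angle n (p - j - (t + int n)) + real l * (2 * pi)"
      by (simp add: algebra_simps)
    then show ?thesis
      by (simp only: g_def force_kernel_periodic[OF assms] sin_cos_add_multiple_2pi)
  qed
  have "(\<Sum>i\<in>{1..n}. sin (real l * angle n (p - int i)) * force_kernel n (j - int i))
      = (\<Sum>i\<in>{1..n}. - g (int i + (- j)))"
    using force_kernel_minus[of n "int i - j" for i] by (simp add: g_def)
  also have "\<dots> = - (\<Sum>u\<in>{1..n}. g (int u))"
    using sum_periodic_shift[of g n, OF g_per] by (simp only: sum_negf)
  also have "(\<Sum>u\<in>{1..n}. g (int u)) =
      sin (real l * angle n (p - j)) * (\<Sum>u\<in>{1..n}. force_kernel n (int u) * cos (real l * angle n (int u)))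
      - cos (real l * angle n (p - j)) * fourier_kernel n l"
  proof -
    have "angle n (p - j - u) = angle n (p - j) - angle n u" for u
      by (simp add: angle_def diff_divide_distrib right_diff_distrib)
    then have "g u = sin (real l * angle n (p - j)) * (force_kernel n u * cos (real l * angle n u))
        - cos (real l * angle n (p - j)) * (force_kernel n u * sin (real l * angle n u))" for u
      by (simp add: g_def right_diff_distrib[of "real l"]
          right_diff_distrib[of "force_kernel n u"] sin_diff left_diff_distrib mult_ac)
    then show ?thesis
      by (simp only: fourier_kernel_def sum_distrib_left sum_subtractf)
  qed
  also have "(\<Sum>u\<in>{1..n}. force_kernel n (int u) * cos (real l * angle n (int u))) = 0"
  proof (rule sum_odd_periodic_eq_0)
    fix t
    show "force_kernel n (t + int n) * cos (real l * angle n (t + int n))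
        = force_kernel n t * cos (real l * angle n t)"
      using assms by (simp only: angle_periodic force_kernel_periodic distrib_left
          sin_cos_add_multiple_2pi)
    show "force_kernel n (- t) * cos (real l * angle n (- t))
        = - (force_kernel n t * cos (real l * angle n t))"
      by (simp add: force_kernel_minus) (simp add: angle_def)
  qed
  finally show ?thesis by simp
qed

text \<open>
  Pairing the balance equations with \<open>sin (l (\<theta>\<^sub>p - \<theta>\<^sub>i))\<close> gives the l-th frequency component of the
  masses at the index p, multiplied by the Fourier coefficient. Hence only the constant component
  survives in the Fourier expansion of \<open>m\<close>.
\<close>

lemma kernel_balanced_imp_mean:
  fixes m :: "nat \<Rightarrow> real"
  assumes "odd n" and p: "p \<in> {1..n}"
    and bal: "\<And>i. i \<in> {1..n} \<Longrightarrow> (\<Sum>j\<in>{1..n}. m j * force_kernel n (int j - int i)) = 0"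
  shows "real n * m p = (\<Sum>j\<in>{1..n}. m j)"
proof -
  have n: "n > 0" using p by simp
  have freq: "(\<Sum>j\<in>{1..n}. m j * cos (real l * angle n (int p - int j))) = 0"
    if "0 < l" "l < n" for l
  proof -
    have "0 = (\<Sum>i\<in>{1..n}. sin (real l * angle n (int p - int i)) *
        (\<Sum>j\<in>{1..n}. m j * force_kernel n (int j - int i)))"
      by (simp add: bal del: One_nat_def)
    also have "\<dots> = (\<Sum>j\<in>{1..n}. m j *
        (\<Sum>i\<in>{1..n}. sin (real l * angle n (int p - int i)) * force_kernel n (int j - int i)))"
      unfolding sum_distrib_left by (subst sum.swap) (simp add: mult_ac)
    also have "\<dots> = fourier_kernel n l * (\<Sum>j\<in>{1..n}. m j * cos (real l * angle n (int p - int j)))"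
      unfolding sum_force_kernel_sin[OF n] sum_distrib_left by (simp add: mult_ac)
    finally show ?thesis using fourier_kernel_nonzero[OF assms(1) that] by simp
  qed
  have orth: "(\<Sum>l<n. cos (real l * angle n (int p - int j))) = (if j = p then real n else 0)"
    if "j \<in> {1..n}" for j
  proof (cases "j = p")
    case True
    then show ?thesis by (simp add: angle_def)
  next
    case False
    have "\<not> int n dvd int p - int j"
      using False p that dvd_imp_le_int[of "int p - int j" "int n"] by auto
    then show ?thesis using sum_cos_multiples_eq_0[OF assms(1)] False by simp
  qed
  \<comment> \<open>Fourier inversion: only the frequency \<open>l = 0\<close> contributes to \<open>m p\<close>.\<close>
  have "real n * m p = (\<Sum>j\<in>{1..n}. m j * (\<Sum>l<n. cos (real l * angle n (int p - int j))))"
    using p by (simp add: orth if_distrib[of "(*) _"] sum.delta cong: if_cong)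
  also have "\<dots> = (\<Sum>l<n. \<Sum>j\<in>{1..n}. m j * cos (real l * angle n (int p - int j)))"
    unfolding sum_distrib_left by (rule sum.swap)
  also have "\<dots> = (\<Sum>l\<in>{0}. \<Sum>j\<in>{1..n}. m j * cos (real l * angle n (int p - int j)))"
    using n freq by (intro sum.mono_neutral_right) auto
  finally show ?thesis by simp
qed

section \<open>The regular polygon\<close>

lemma inner_regular_polygon:
  "regular_polygon n i \<bullet> regular_polygon n j = cos (angle n (int j - int i))"
  by (simp add: inner_vec_def sum_4 regular_polygon_components angle_def diff_divide_distrib
      right_diff_distrib cos_diff)

lemma regular_polygon_nonsingular:
  assumes "odd n"
  shows "regular_polygon n \<in> sphere_configs n - singular_set n"
proof -
  have "regular_polygon n i \<in> sphere 0 1" for i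
    using inner_regular_polygon[of n i i] by (simp add: norm_eq_sqrt_inner angle_def)
  moreover have False
    if ij: "1 \<le> i" "i < j" "j \<le> n"
      and eq: "regular_polygon n i = regular_polygon n j \<or> regular_polygon n i = - regular_polygon n j"
    for i j
  proof -
    have unit: "regular_polygon n j \<bullet> regular_polygon n j = 1"
      by (simp add: inner_regular_polygon angle_def)
    have "(cos (angle n (int j - int i)))\<^sup>2 = 1"
      using eq unit by (auto simp flip: inner_regular_polygon)
    then have "sin (angle n (int j - int i)) = 0"
      using sin_cos_squared_add[of "angle n (int j - int i)"] by simp
    then have "int n dvd int j - int i" using sin_angle_eq_0_iff[OF assms] by blast
    then show False using ij by (auto dest!: zdvd_imp_le)
  qed
  ultimately show ?thesis by (auto simp: sphere_configs_def singular_set_def)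
qed

text \<open>
  With \<open>d\<close> the signed angle from the i-th to the j-th point, the spherical distance has sine
  \<open>\<bar>sin d\<bar>\<close>, and the projection of the j-th point to the tangent space at the i-th one is
  \<open>sin d\<close> times the unit tangent of the circle. Their quotient produces the kernel \<open>s\<close>.
\<close>

lemma grad_potential_regular_polygon:
  assumes "i \<in> {1..n}"
  shows "grad_potential n m (regular_polygon n) i =
    (m i * (\<Sum>j\<in>{1..n}. m j * force_kernel n (int j - int i))) *\<^sub>R
      vector [- sin (angle n (int i)), cos (angle n (int i)), 0, 0]"
proof -
  define \<tau> :: "real^4" where "\<tau> = vector [- sin (angle n (int i)), cos (angle n (int i)), 0, 0]"
  have \<tau>: "\<tau> $ 1 = - sin (angle n (int i))" "\<tau> $ 2 = cos (angle n (int i))" "\<tau> $ 3 = 0" "\<tau> $ 4 = 0"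
    by (simp_all add: \<tau>_def vector_def)
  have summand: "(m i * m j / sin (sdist (regular_polygon n i) (regular_polygon n j)) ^ 3) *\<^sub>R
      (regular_polygon n j - cos (sdist (regular_polygon n i) (regular_polygon n j)) *\<^sub>R regular_polygon n i)
      = (m i * (m j * force_kernel n (int j - int i))) *\<^sub>R \<tau>" for j
  proof -
    define x where "x = angle n (int i)"
    define d where "d = angle n (int j - int i)"
    have jx: "angle n (int j) = x + d"
      by (simp add: d_def x_def angle_def diff_divide_distrib right_diff_distrib)
    have dir: "regular_polygon n j - cos d *\<^sub>R regular_polygon n i = sin d *\<^sub>R \<tau>"
    proof -
      have "cos x = cos d * (cos d * cos x) + sin d * (sin d * cos x)"
           "sin x = cos d * (cos d * sin x) + sin d * (sin d * sin x)"
        by (metis (no_types) distrib_right mult.assoc mult_1 power2_eq_square sin_cos_squared_add2)+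
      then show ?thesis
        by (simp add: vec_eq_iff forall_4 regular_polygon_components \<tau>
            flip: x_def[unfolded angle_def] jx[unfolded angle_def])
          (simp add: regular_polygon_components sin_add cos_add x_def angle_def
            jx[unfolded angle_def x_def, simplified])
    qed
    have "sin (sdist (regular_polygon n i) (regular_polygon n j)) = \<bar>sin d\<bar>"
      unfolding sdist_def inner_regular_polygon d_def[symmetric]
      by (simp add: sin_arccos_abs flip: sin_squared_eq)
    moreover have "cos (sdist (regular_polygon n i) (regular_polygon n j)) = cos d"
      unfolding sdist_def inner_regular_polygon d_def[symmetric] by (simp add: cos_arccos_abs)
    ultimately show ?thesis
      using dir by (simp add: force_kernel_def d_def)
  qed
  have "grad_potential n m (regular_polygon n) i
      = (\<Sum>j\<in>{1..n} - {i}. (m i * (m j * force_kernel n (int j - int i))) *\<^sub>R \<tau>)"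
    by (simp add: grad_potential_def summand)
  also have "\<dots> = (\<Sum>j\<in>{1..n}. (m i * (m j * force_kernel n (int j - int i))) *\<^sub>R \<tau>)"
    \<comment> \<open>the term at \<open>j = i\<close> is \<open>0 / 0 = 0\<close>\<close>
    using assms by (intro sum.mono_neutral_left) (auto simp: force_kernel_def angle_def)
  finally show ?thesis
    by (simp add: \<tau>_def scaleR_sum_left sum_distrib_left)
qed

theorem theorem4:
  fixes n :: nat and m :: "nat \<Rightarrow> real"
  assumes "n > 1" and "odd n"
    and "\<forall>i\<in>{1..n}. m i > 0"
  shows "equilibrium n m (regular_polygon n) \<longleftrightarrow> (\<forall>i\<in>{1..n}. \<forall>j\<in>{1..n}. m i = m j)"
proof -
  have tangent: "(vector [- sin x, cos x, 0, 0] :: real^4) \<noteq> 0" for x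
  proof
    assume eq: "(vector [- sin x, cos x, 0, 0] :: real^4) = 0"
    have "sin x = 0" "cos x = 0"
      using arg_cong[OF eq, of "\<lambda>v. v $ 1"] arg_cong[OF eq, of "\<lambda>v. v $ 2"]
      by (simp_all add: vector_def)
    then show False using sin_cos_squared_add[of x] by simp
  qed
  have "equilibrium n m (regular_polygon n) \<longleftrightarrow>
      (\<forall>i\<in>{1..n}. (\<Sum>j\<in>{1..n}. m j * force_kernel n (int j - int i)) = 0)"
    unfolding equilibrium_iff_grad_potential
    using assms tangent regular_polygon_nonsingular[OF assms(2)]
    by (simp add: grad_potential_regular_polygon less_imp_neq[THEN not_sym] del: One_nat_def)
  also have "\<dots> \<longleftrightarrow> (\<forall>i\<in>{1..n}. \<forall>j\<in>{1..n}. m i = m j)"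
  proof safe
    fix i j assume *: "\<forall>i\<in>{1..n}. (\<Sum>j\<in>{1..n}. m j * force_kernel n (int j - int i)) = 0"
      and ij: "i \<in> {1..n}" "j \<in> {1..n}"
    have "real n * m i = real n * m j"
      using * ij kernel_balanced_imp_mean[OF assms(2), of _ m] by simp
    then show "m i = m j" using assms by simp
  next
    fix i assume *: "\<forall>i\<in>{1..n}. \<forall>j\<in>{1..n}. m i = m j" and i: "i \<in> {1..n}"
    have n: "n > 0" using assms by simp
    have "(\<Sum>j\<in>{1..n}. m j * force_kernel n (int j - int i))
        = (\<Sum>j\<in>{1..n}. m i * force_kernel n (int j + (- int i)))"
    proof (intro sum.cong refl)
      fix j assume "j \<in> {1..n}"
      then have "m j = m i" using * i by blast
      then show "m j * force_kernel n (int j - int i) = m i * force_kernel n (int j + (- int i))"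
        by simp
    qed
    also have "\<dots> = m i * (\<Sum>j\<in>{1..n}. force_kernel n (int j))"
      using sum_periodic_shift[of "force_kernel n" n, OF force_kernel_periodic[OF n]]
      by (simp only: sum_distrib_left[symmetric])
    also have "(\<Sum>j\<in>{1..n}. force_kernel n (int j)) = 0"
      by (rule sum_odd_periodic_eq_0) (simp_all add: force_kernel_periodic n force_kernel_minus)
    finally show "(\<Sum>j\<in>{1..n}. m j * force_kernel n (int j - int i)) = 0" by simp
  qed
  finally show ?thesis .
qed

end
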